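(* Let $m\in(0,\infty)$, let $\{W_x : x\in\mathbb{N}_{\ge 1}\}$ be an independent family of exponential random variables with common mean $m$, and let $N$ be the random measure on $(\mathbb{R}_{>0},\mathscr{B}_{\mathbb{R}_{>0}})$ with fixed atoms $\mathbb{N}_{\ge1}$ and random weights $\{W_x\}$, i.e. $N(A)=\sum_{x\in\mathbb{N}_{\ge1}} W_x\,\mathbf{1}_A(x)$ for every Borel set $A\subseteq\mathbb{R}_{>0}$. Let $f(x)=1/x^2$ for $x\in\mathbb{R}_{>0}$, and let $$Nf=\int_{\mathbb{R}_{>0}} N(\mathrm{d}x)f(x)=\sum_{x\ge 1}\frac{W_x}{x^2}.$$ Then $Nf$ has Laplace transform $$F(\alpha)=\mathbb{E}\,e^{-\alpha Nf}=\sqrt{\alpha m}\,\pi\,\operatorname{csch}\!\left(\sqrt{\alpha m}\,\pi\right)\quad\text{for }\alpha\in\mathbb{R}_{\ge 0}$$ (with the right-hand side understood as its limit $1$ at $\alpha=0$), cumulative distribution function $$\mathbb{P}(Nf\le x)=\sqrt{\frac{m\pi}{x}}\;\theta_2\!\left(0,e^{-\frac{m\pi^2}{x}}\right)\quad\text{for } x>0,$$ and the distribution $\eta$ of $Nf$ has density with respect to Lebesgue measure on $(0,\infty)$ given by $$\eta(\mathrm{d}x)=\frac{\sqrt{m\pi}}{2x^{5/2}}\left(2m\pi^2\left(\frac{\theta_2\!\left(0,e^{-\frac{m\pi^2}{x}}\right)}{4}+2e^{-\frac{m\pi^2}{x}}\sum_{k\ge1}k(k+1)\left(e^{-\frac{m\pi^2}{x}}\right)^{k(k+1)-3/4}\right)-x\,\theta_2\!\left(0,e^{-\frac{m\pi^2}{x}}\right)\right)\mathrm{d}x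 .$$
   Context: The Jacobi theta function is $$\theta_2(z,q)=2q^{1/4}\sum_{k=0}^\infty q^{k(k+1)}\cos((2k+1)z),$$ used here for $z=0$ and $q\in(0,1)$. The hyperbolic cosecant is $\operatorname{csch}(t)=1/\sinh(t)$. $\mathbb{N}_{\ge1}=\{1,2,3,\dots\}$, $\mathscr{B}_{\mathbb{R}_{>0}}$ is the Borel $\sigma$-algebra of $\mathbb{R}_{>0}=(0,\infty)$, and $\mathbf{1}_A$ is the indicator function of $A$. The distribution of $Nf$ is $\eta(\mathrm{d}x)=\mathbb{P}(Nf\in\mathrm{d}x)$. An exponential random variable with mean $m$ has density $m^{-1}e^{-z/m}$ on $z>0$. *)

theory Defs
  imports "HOL-Probability.Probability"
begin

definition csch :: "real \<Rightarrow> real" where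
  "csch t = 1 / sinh t"

definition jacobi_theta2 :: "real \<Rightarrow> real \<Rightarrow> real" where
  "jacobi_theta2 z q =
     2 * q powr (1/4) * (\<Sum>k. q ^ (k * (k + 1)) * cos ((2 * real k + 1) * z))"

abbreviation borel_pos :: "real measure" where
  "borel_pos \<equiv> restrict_space borel {0<..}"

end

theory Submission
  imports Defs "HOL-Real_Asymp.Real_Asymp"
begin

text \<open>
  Since \<open>Nf\<close> is the almost sure limit of its partial sums, its Laplace transform is the product of the factors
  \<open>1 / (1 + \<alpha>m/k\<^sup>2)\<close>, which Euler's product for the sine turns into the \<open>csch\<close> expression. The
  Laplace transform of the distribution function is this expression divided by \<open>\<alpha>\<close>. Integrating the
  theta series term by term, with
  \<open>\<integral>\<^sub>0\<^sup>\<infinity> t\<^sup>-\<^sup>1\<^sup>/\<^sup>2 exp (- at - b/t) dt = \<surd>(\<pi>/a) exp (- 2\<surd>(ab))\<close>,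
  gives a geometric series with the same value. Both functions are continuous on \<open>(0, \<infinity>)\<close>
  (\<open>Nf\<close> has no atoms because \<open>W\<^sub>1\<close> has a density and is independent of the rest), so they agree by
  uniqueness of Laplace transforms; no theta transformation formula is needed. The density is the
  derivative of the theta expression, and it is nonnegative because a distribution function is monotone.
\<close>

subsection \<open>Laplace transforms\<close>

text \<open>The witness is a rescaled standard normal distribution function, so both limits are
  those of a distribution function and no Gaussian integral has to be evaluated.\<close>

lemma gauss_antiderivative:
  obtains P :: "real \<Rightarrow> real" where
    "\<And>s. (P has_real_derivative exp (- s\<^sup>2)) (at s)"
    "(P \<longlongrightarrow> sqrt pi) at_top" "(P \<longlongrightarrow> 0) at_bot"
proof -
  let ?D = "density lborel std_normal_density"
  interpret D: prob_space ?D by (rule prob_space_normal_density) simp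
  interpret D: real_distribution ?D by unfold_locales auto
  have deriv: "(cdf ?D has_real_derivative std_normal_density s) (at s)" for s
  proof -
    let ?a = "s - 1" and ?b = "s + 1"
    have cont: "continuous_on A std_normal_density" for A
      unfolding std_normal_density_def by (intro continuous_intros) auto
    \<comment> \<open>On a window around \<open>s\<close> the distribution function is a constant
      plus an integral with fixed lower limit, which puts it in the form required by the fundamental
      theorem of calculus.\<close>
    have eq: "cdf ?D x = cdf ?D ?a + integral {?a..x} std_normal_density" if "x \<in> {?a<..<?b}" for x
    proof -
      have "cdf ?D x - cdf ?D ?a = measure ?D {?a<..x}"
        using that by (intro D.cdf_diff_eq) auto
      also have "\<dots> = enn2real (\<integral>\<^sup>+ u. ennreal (std_normal_density u) * indicator {?a<..x} u \<partial>lborel)"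
        by (simp add: measure_def emeasure_density)
      also have "(\<integral>\<^sup>+ u. ennreal (std_normal_density u) * indicator {?a<..x} u \<partial>lborel)
          = (\<integral>\<^sup>+ u. ennreal (std_normal_density u) * indicator {?a..x} u \<partial>lborel)"
        by (intro nn_integral_cong_AE) (use AE_lborel_singleton[of ?a] in eventually_elim, auto split: split_indicator)
      also have "\<dots> = ennreal (integral {?a..x} std_normal_density)"
        using nn_integral_has_integral_lebesgue[OF _ integrable_integral[OF integrable_continuous_real[OF cont]], of "?a" x]
        by (simp add: ennreal_mult'' ennreal_indicator mult.commute)
      finally show ?thesis
        by (simp add: integral_nonneg integrable_continuous_real cont)
    qed
    have "((\<lambda>x. cdf ?D ?a + integral {?a..x} std_normal_density) has_real_derivative std_normal_density s) (at s within {?a<..<?b})"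
      by (rule DERIV_subset[where s="{?a..?b}"])
         (auto intro!: derivative_eq_intros integral_has_real_derivative cont)
    then have "((\<lambda>x. cdf ?D ?a + integral {?a..x} std_normal_density) has_real_derivative std_normal_density s) (at s)"
      by (subst (asm) at_within_open) auto
    then show ?thesis
      by (rule has_field_derivative_transform_within_open[where S="{?a<..<?b}"]) (use eq in auto)
  qed
  \<comment> \<open>The normal density at \<open>sqrt 2 * s\<close> is
    \<open>exp (- s\<^sup>2) / sqrt (2 * pi)\<close>; the inner factor \<open>sqrt 2\<close> and the
    outer factor \<open>sqrt pi\<close> cancel the constant.\<close>
  define P where "P s = sqrt pi * cdf ?D (sqrt 2 * s)" for s
  have "(P has_real_derivative exp (- s\<^sup>2)) (at s)" for s
    unfolding P_def
    by (rule derivative_eq_intros DERIV_chain2[OF deriv] refl)+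
       (simp add: std_normal_density_def power_mult_distrib real_sqrt_mult)
  moreover have "(P \<longlongrightarrow> sqrt pi * 1) at_top"
    unfolding P_def
    by (intro tendsto_intros filterlim_compose[OF D.cdf_lim_at_top_prob] filterlim_tendsto_pos_mult_at_top[OF tendsto_const]
         filterlim_ident) auto
  moreover have "(P \<longlongrightarrow> sqrt pi * 0) at_bot"
    unfolding P_def
    by (intro tendsto_intros filterlim_compose[OF D.cdf_lim_at_bot] filterlim_tendsto_pos_mult_at_bot[OF tendsto_const]
         filterlim_ident) auto
  ultimately show ?thesis by (intro that[of P]) simp_all
qed

text \<open>The exponent \<open>a * t + b / t\<close> is a square in two ways,
  \<open>(v t)\<^sup>2 + 2 * c\<close> and \<open>(u t)\<^sup>2 - 2 * c\<close>. Adding the two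
  resulting substitutions into the Gaussian cancels the \<open>sqrt b\<close> parts of
  \<open>u'\<close> and \<open>v'\<close> and leaves \<open>sqrt a / sqrt t\<close>, so
  \<open>F\<close> is an explicit antiderivative.\<close>

lemma nn_integral_inverse_sqrt_exp:
  fixes a b :: real
  assumes a: "a > 0" and b: "b > 0"
  shows "(\<integral>\<^sup>+ t. ennreal (exp (- a * t - b / t) / sqrt t) * indicator {0<..} t \<partial>lborel)
    = ennreal (sqrt (pi / a) * exp (- 2 * sqrt (a * b)))"
proof -
  obtain P :: "real \<Rightarrow> real" where P: "\<And>s. (P has_real_derivative exp (- s\<^sup>2)) (at s)"
    and top: "(P \<longlongrightarrow> sqrt pi) at_top" and bot: "(P \<longlongrightarrow> 0) at_bot"
    using gauss_antiderivative by blast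
  define c where "c = sqrt (a * b)"
  define u where "u t = sqrt a * sqrt t + sqrt b / sqrt t" for t
  define v where "v t = sqrt a * sqrt t - sqrt b / sqrt t" for t
  define F where "F t = (exp (- 2 * c) * P (v t) + exp (2 * c) * P (u t)) / sqrt a" for t
  let ?f = "\<lambda>t. exp (- a * t - b / t) / sqrt t"
  have deriv: "(F has_real_derivative ?f t) (at t)" if "t > 0" for t
  proof -
    have u2: "(u t)\<^sup>2 = a * t + b / t + 2 * c" and v2: "(v t)\<^sup>2 = a * t + b / t - 2 * c"
      using that a b by (auto simp: u_def v_def c_def power2_sum power2_diff power_mult_distrib power_divide real_sqrt_mult)
    have du: "(u has_real_derivative (sqrt a / (2 * sqrt t) - sqrt b / (2 * t * sqrt t))) (at t)"
      unfolding u_def using that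
      by (auto intro!: derivative_eq_intros simp: field_simps)
    have dv: "(v has_real_derivative (sqrt a / (2 * sqrt t) + sqrt b / (2 * t * sqrt t))) (at t)"
      unfolding v_def using that
      by (auto intro!: derivative_eq_intros simp: field_simps)
    have e1: "exp (- 2 * c) * exp (- (v t)\<^sup>2) = exp (- a * t - b / t)"
      and e2: "exp (2 * c) * exp (- (u t)\<^sup>2) = exp (- a * t - b / t)"
      by (simp_all add: u2 v2 flip: exp_add)
    have "(F has_real_derivative
       ((exp (- 2 * c) * (exp (- (v t)\<^sup>2) * (sqrt a / (2 * sqrt t) + sqrt b / (2 * t * sqrt t)))
       + exp (2 * c) * (exp (- (u t)\<^sup>2) * (sqrt a / (2 * sqrt t) - sqrt b / (2 * t * sqrt t)))) / sqrt a)) (at t)"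
      unfolding F_def by (intro DERIV_cdivide DERIV_add DERIV_cmult DERIV_chain2[OF P] du dv)
    also have "((exp (- 2 * c) * (exp (- (v t)\<^sup>2) * (sqrt a / (2 * sqrt t) + sqrt b / (2 * t * sqrt t)))
       + exp (2 * c) * (exp (- (u t)\<^sup>2) * (sqrt a / (2 * sqrt t) - sqrt b / (2 * t * sqrt t)))) / sqrt a) = ?f t"
      unfolding mult.assoc[symmetric] e1 e2 using a that by (simp add: field_simps)
    finally show ?thesis .
  qed
  \<comment> \<open>The argument \<open>u\<close> tends to infinity at both ends of the half-line,
    while \<open>v\<close> runs from minus infinity to infinity. Hence only the \<open>v\<close>
    term contributes to the difference of the limits.\<close>
  have lim_0: "(F \<longlongrightarrow> (exp (- 2 * c) * 0 + exp (2 * c) * sqrt pi) / sqrt a) (at_right 0)"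
  proof -
    have "filterlim u at_top (at_right 0)" "filterlim v at_bot (at_right 0)"
      unfolding u_def v_def using a b by real_asymp+
    then show ?thesis
      unfolding F_def using a
      by (intro tendsto_intros filterlim_compose[OF top] filterlim_compose[OF bot]) auto
  qed
  have lim_inf: "(F \<longlongrightarrow> (exp (- 2 * c) * sqrt pi + exp (2 * c) * sqrt pi) / sqrt a) at_top"
  proof -
    have "filterlim u at_top at_top" "filterlim v at_top at_top"
      unfolding u_def v_def using a b by real_asymp+
    then show ?thesis
      unfolding F_def using a
      by (intro tendsto_intros filterlim_compose[OF top] filterlim_compose[OF bot]) auto
  qed
  have *: "set_integrable lborel (einterval 0 \<infinity>) ?f" 
      "(LBINT t=0..\<infinity>. ?f t) = (exp (- 2 * c) * sqrt pi + exp (2 * c) * sqrt pi) / sqrt a - (exp (- 2 * c) * 0 + exp (2 * c) * sqrt pi) / sqrt a"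
    using deriv lim_0 lim_inf
    by (intro interval_integral_FTC_nonneg[where F = F]; 
        force simp: ereal_tendsto_simps zero_ereal_def isCont_def intro!: tendsto_eq_intros)+
  have "(\<integral>\<^sup>+ t. ennreal (?f t) * indicator {0<..} t \<partial>lborel) = (\<integral>\<^sup>+ t. ennreal (indicator {0<..} t *\<^sub>R ?f t) \<partial>lborel)"
    by (intro nn_integral_cong) (auto split: split_indicator)
  also have "\<dots> = ennreal (LINT t|lborel. indicator {0<..} t *\<^sub>R ?f t)"
    using *(1) by (intro nn_integral_eq_integral)
      (auto simp: set_integrable_def zero_ereal_def einterval_eq_Ici split: split_indicator)
  also have "(LINT t|lborel. indicator {0<..} t *\<^sub>R ?f t) = (LBINT t=0..\<infinity>. ?f t)"
    by (simp add: interval_lebesgue_integral_def set_lebesgue_integral_def zero_ereal_def einterval_eq_Ici)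
  also have "\<dots> = sqrt (pi / a) * exp (- 2 * sqrt (a * b))"
    unfolding *(2) using a by (simp add: c_def field_simps real_sqrt_divide)
  finally show ?thesis .
qed

lemma nn_integral_exp_Ici:
  fixes \<alpha> s :: real
  assumes "\<alpha> > 0"
  shows "(\<integral>\<^sup>+ t. ennreal (exp (- (\<alpha> * t))) * indicator {s..} t \<partial>lborel) = ennreal (exp (- (\<alpha> * s)) / \<alpha>)"
proof -
  have "(\<integral>\<^sup>+ t. ennreal (exp (- (\<alpha> * t))) * indicator {s..} t \<partial>lborel) = ennreal (0 - (- exp (- (\<alpha> * s)) / \<alpha>))"
  proof (rule nn_integral_FTC_atLeast)
    show "((\<lambda>t. - exp (- (\<alpha> * t)) / \<alpha>) \<longlongrightarrow> 0) at_top"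
      using assms by real_asymp
  qed (use assms in \<open>auto intro!: derivative_eq_intros\<close>)
  then show ?thesis by simp
qed

section \<open>Uniqueness of Laplace transforms\<close>

text \<open>The positive integers suffice as transform arguments: with \<open>u = exp (- t)\<close>
  the kernels are the monomials in \<open>u\<close>, so the difference \<open>h\<close> pairs to
  zero with polynomials, and by Stone-Weierstrass with continuous functions on [0, 1]. A test
  function with the sign of \<open>h\<close> then gives \<open>h = 0\<close> almost everywhere, and
  continuity gives it everywhere.\<close>

lemma laplace_transform_unique:
  fixes F G :: "real \<Rightarrow> real"
  assumes cont: "continuous_on {0<..} F" "continuous_on {0<..} G"
    and nonneg: "\<And>t. t > 0 \<Longrightarrow> F t \<ge> 0" "\<And>t. t > 0 \<Longrightarrow> G t \<ge> 0"
    and eq: "\<And>n. n \<ge> 1 \<Longrightarrow> (\<integral>\<^sup>+ t. ennreal (exp (- (real n * t)) * F t) * indicator {0<..} t \<partial>lborel)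
        = (\<integral>\<^sup>+ t. ennreal (exp (- (real n * t)) * G t) * indicator {0<..} t \<partial>lborel)"
    and fin: "(\<integral>\<^sup>+ t. ennreal (exp (- t) * F t) * indicator {0<..} t \<partial>lborel) < \<infinity>"
    and "t > 0"
  shows "F t = G t"
proof -
  define h where "h t = F t - G t" for t
  have cont_h: "continuous_on {0<..} h"
    unfolding h_def by (intro continuous_intros cont)
  have mom: "integrable lborel (\<lambda>t. indicator {0<..} t * (exp (- (real n * t)) * h t))
      \<and> (LINT t|lborel. indicator {0<..} t * (exp (- (real n * t)) * h t)) = 0" if n: "n \<ge> 1" for n :: nat
  proof -
    define f where "f H t = indicator {0<..} t * (exp (- (real n * t)) * H t)" for H :: "real \<Rightarrow> real" and t :: real
    have meas: "f H \<in> borel_measurable lborel" if "continuous_on {0<..} H" for H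
    proof -
      have "continuous_on {0<..} (\<lambda>t. exp (- (real n * t)) * H t)"
        using that by (intro continuous_intros)
      from borel_measurable_continuous_on_indicator[OF _ this] show ?thesis
        by (simp add: f_def[abs_def])
    qed
    have nn: "(\<integral>\<^sup>+ t. ennreal (f H t) \<partial>lborel) = (\<integral>\<^sup>+ t. ennreal (exp (- (real n * t)) * H t) * indicator {0<..} t \<partial>lborel)" for H
      by (intro nn_integral_cong) (auto simp: f_def split: split_indicator)
    have f0: "f F t \<ge> 0" "f G t \<ge> 0" for t
      using nonneg by (auto simp: f_def split: split_indicator)
    \<comment> \<open>Finiteness at \<open>n = 1\<close> covers all \<open>n\<close>, since
      \<open>exp (- (n * t))\<close> is at most \<open>exp (- t)\<close> for positive
      \<open>t\<close>; for \<open>G\<close> it follows from the equality of the integrals.\<close>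
    have "(\<integral>\<^sup>+ t. ennreal (f F t) \<partial>lborel) \<le> (\<integral>\<^sup>+ t. ennreal (exp (- t) * F t) * indicator {0<..} t \<partial>lborel)"
      unfolding nn using n nonneg
      by (intro nn_integral_mono) (auto split: split_indicator intro!: ennreal_leI mult_right_mono)
    with fin have fF: "(\<integral>\<^sup>+ t. ennreal (f F t) \<partial>lborel) < \<infinity>" by (rule le_less_trans[rotated])
    have FG: "(\<integral>\<^sup>+ t. ennreal (f F t) \<partial>lborel) = (\<integral>\<^sup>+ t. ennreal (f G t) \<partial>lborel)"
      unfolding nn by (rule eq[OF n])
    have iF: "integrable lborel (f F)" and iG: "integrable lborel (f G)"
      using fF f0 by (auto intro!: integrableI_nonneg meas cont simp: FG)
    have "(LINT t|lborel. f F t) = (LINT t|lborel. f G t)"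
      using FG f0 meas[OF cont(1)] meas[OF cont(2)] by (subst (1 2) integral_eq_nn_integral) auto
    with iF iG have "integrable lborel (\<lambda>t. f F t - f G t)" "(LINT t|lborel. f F t - f G t) = 0"
      by auto
    moreover have "f F t - f G t = indicator {0<..} t * (exp (- (real n * t)) * h t)" for t
      by (simp add: f_def h_def algebra_simps)
    ultimately show ?thesis by simp
  qed
  \<comment> \<open>One factor \<open>exp (- t)\<close> is kept inside \<open>K\<close> to make it
    integrable, so the \<open>i\<close>-th power moment of \<open>K\<close> is the case
    \<open>n = i + 1\<close> of \<open>mom\<close>.\<close>
  define K where "K t = indicator {0<..} t * (exp (- t) * h t)" for t :: real
  have iK: "integrable lborel K"
    using mom[of 1] by (simp add: K_def[abs_def])
  have K_pow: "integrable lborel (\<lambda>t. K t * exp (- t) ^ i)" "(LINT t|lborel. K t * exp (- t) ^ i) = 0" for i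
  proof -
    have "K t * exp (- t) ^ i = indicator {0<..} t * (exp (- (real (Suc i) * t)) * h t)" for t
      by (simp add: K_def exp_of_nat_mult[symmetric] exp_add algebra_simps exp_diff exp_minus divide_simps)
    with mom[of "Suc i"] show "integrable lborel (\<lambda>t. K t * exp (- t) ^ i)" "(LINT t|lborel. K t * exp (- t) ^ i) = 0"
      by simp_all
  qed
  \<comment> \<open>A continuous function on the unit interval whose pairing with K is the integral of a nonnegative
    function; dividing by \<open>1 + h\<^sup>2\<close> makes it bounded.\<close>
  define b where "b t = h t / (1 + (h t)\<^sup>2)" for t
  have h_pos: "1 + (h t)\<^sup>2 > 0" for t
    by (simp add: add_pos_nonneg)
  have b_le: "\<bar>b t\<bar> \<le> 1" for t
  proof -
    have "\<bar>h t\<bar> \<le> 1 + (h t)\<^sup>2"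
      using zero_le_power2[of "\<bar>h t\<bar> - 1/2"] by (simp add: power2_diff) (simp add: power2_eq_square)
    then show ?thesis by (auto simp: b_def divide_le_eq add_pos_nonneg)
  qed
  have cont_b: "continuous_on {0<..} b"
    unfolding b_def by (intro continuous_intros cont_h) (use h_pos in \<open>auto simp: less_le\<close>)
  \<comment> \<open>The factor \<open>u * (1 - u)\<close> forces continuity at 0 and 1. These
    correspond to \<open>t\<close> tending to infinity and to 0, where \<open>b\<close> may have no
    limit but is bounded.\<close>
  define \<phi> where "\<phi> u = u * (1 - u) * b (- ln u)" for u :: real
  have cont_\<phi>: "continuous_on {0..1} \<phi>"
    unfolding continuous_on_eq_continuous_within
  proof
    fix u :: real assume u: "u \<in> {0..1}"
    show "continuous (at u within {0..1}) \<phi>"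
    proof (cases "u = 0 \<or> u = 1")
      case True
      have lim0: "((\<lambda>u. u * (1 - u)) \<longlongrightarrow> 0) (at u within {0..1})"
        using True by (auto intro!: tendsto_eq_intros)
      have "(\<phi> \<longlongrightarrow> 0) (at u within {0..1})"
      proof (rule Lim_null_comparison[OF _ lim0])
        show "\<forall>\<^sub>F x in at u within {0..1}. norm (\<phi> x) \<le> x * (1 - x)"
          unfolding eventually_at_filter
        proof (intro always_eventually allI impI)
          fix x :: real assume x: "x \<in> {0..1}"
          have "\<bar>\<phi> x\<bar> = x * (1 - x) * \<bar>b (- ln x)\<bar>"
            using x by (auto simp: \<phi>_def abs_mult)
          also have "\<dots> \<le> x * (1 - x) * 1"
            using x by (intro mult_left_mono b_le) auto
          finally show "norm (\<phi> x) \<le> x * (1 - x)" by simp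
        qed
      qed
      with True show ?thesis by (auto simp: continuous_within \<phi>_def)
    next
      case False
      with u have u: "0 < u" "u < 1" by auto
      have "isCont b (- ln u)"
        using cont_b u by (simp add: continuous_on_eq_continuous_at)
      moreover have "isCont (\<lambda>u. - ln u) u"
        using u by (intro continuous_intros) auto
      ultimately have "isCont (\<lambda>u. b (- ln u)) u"
        by (rule isCont_o2[rotated])
      then have "isCont \<phi> u"
        unfolding \<phi>_def by (intro continuous_intros)
      then show ?thesis by (rule continuous_at_imp_continuous_at_within)
    qed
  qed
  have \<phi>_bound: "\<bar>\<phi> u\<bar> \<le> 1" if "u \<in> {0..1}" for u
  proof -
    have "\<bar>\<phi> u\<bar> = u * (1 - u) * \<bar>b (- ln u)\<bar>"
      using that by (auto simp: \<phi>_def abs_mult)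
    also have "\<dots> \<le> 1 * 1 * 1"
      using that by (intro mult_mono b_le) auto
    finally show ?thesis by simp
  qed
  have meas: "(\<lambda>t. K t * \<phi> (exp (- t))) \<in> borel_measurable lborel"
  proof -
    have "(\<lambda>t. indicator {0<..} t *\<^sub>R (exp (- t) * h t * \<phi> (exp (- t)))) \<in> borel_measurable borel"
      by (intro borel_measurable_continuous_on_indicator continuous_intros cont_h
          continuous_on_compose2[OF cont_\<phi>]) auto
    then show ?thesis by (simp add: K_def mult_ac)
  qed
  have i\<phi>: "integrable lborel (\<lambda>t. K t * \<phi> (exp (- t)))"
  proof (rule Bochner_Integration.integrable_bound[OF iK meas])
    have "\<bar>K t\<bar> * \<bar>\<phi> (exp (- t))\<bar> \<le> \<bar>K t\<bar>" for t
      using \<phi>_bound[of "exp (-t)"] by (cases "t > 0") (auto simp: K_def mult_left_le abs_mult)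
    then show "AE t in lborel. norm (K t * \<phi> (exp (- t))) \<le> norm (K t)"
      by (simp add: abs_mult)
  qed
  \<comment> \<open>A polynomial within \<open>e\<close> of \<phi> pairs to zero with
    \<open>K\<close>, so only the approximation error is left.\<close>
  have small: "\<bar>LINT t|lborel. K t * \<phi> (exp (- t))\<bar> \<le> e * (LINT t|lborel. \<bar>K t\<bar>)" if e: "e > 0" for e
  proof -
    obtain p where "real_polynomial_function p" and p: "\<And>x. x \<in> {0..1} \<Longrightarrow> \<bar>\<phi> x - p x\<bar> < e"
      using Stone_Weierstrass_real_polynomial_function[OF compact_Icc cont_\<phi> e] by blast
    then obtain a d where p_eq: "p = (\<lambda>x. \<Sum>i\<le>d. a i * x ^ i)"
      unfolding real_polynomial_function_iff_sum by blast
    have Kp: "K t * p (exp (- t)) = (\<Sum>i\<le>d. a i * (K t * exp (- t) ^ i))" for t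
      by (simp add: p_eq sum_distrib_left mult_ac)
    have ip: "integrable lborel (\<lambda>t. K t * p (exp (- t)))" "(LINT t|lborel. K t * p (exp (- t))) = 0"
      unfolding Kp using K_pow by (auto simp: Bochner_Integration.integral_sum)
    have "(LINT t|lborel. K t * \<phi> (exp (- t))) = (LINT t|lborel. K t * \<phi> (exp (- t)) - K t * p (exp (- t)))"
      using i\<phi> ip by simp
    also have "\<bar>\<dots>\<bar> \<le> (LINT t|lborel. e * \<bar>K t\<bar>)"
    proof (rule integral_abs_bound_integral)
      fix t
      have "\<bar>K t * \<phi> (exp (- t)) - K t * p (exp (- t))\<bar> = \<bar>K t\<bar> * \<bar>\<phi> (exp (- t)) - p (exp (- t))\<bar>"
        by (simp add: abs_mult right_diff_distrib[symmetric])
      also have "\<dots> \<le> \<bar>K t\<bar> * e"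
        using p[of "exp (- t)"] by (cases "t > 0") (auto simp: K_def intro!: mult_left_mono)
      finally show "\<bar>K t * \<phi> (exp (- t)) - K t * p (exp (- t))\<bar> \<le> e * \<bar>K t\<bar>" by (simp add: mult.commute)
    qed (use i\<phi> ip iK in auto)
    finally show ?thesis by simp
  qed
  have int0: "(LINT t|lborel. K t * \<phi> (exp (- t))) = 0"
  proof (rule ccontr)
    define A B where "A = \<bar>LINT t|lborel. K t * \<phi> (exp (- t))\<bar>" and "B = (LINT t|lborel. \<bar>K t\<bar>)"
    assume "\<not> ?thesis"
    then have A: "A > 0" by (simp add: A_def)
    have B: "B \<ge> 0" by (simp add: B_def)
    \<comment> \<open>The choice of \<open>e\<close> uses \<open>B + 1\<close> because
      \<open>B\<close> may be zero; the right-hand side is below half of \<open>A\<close>.\<close>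
    have "A \<le> A / (2 * (B + 1)) * B"
      using small[of "A / (2 * (B + 1))", folded A_def B_def] A B by simp
    also have "\<dots> < A"
      using A B by (simp add: field_simps) (auto intro: add_nonneg_pos)
    finally show False by simp
  qed
  have K\<phi>: "K t * \<phi> (exp (- t)) = indicator {0<..} t * (exp (- t) * exp (- t) * (1 - exp (- t)) * ((h t)\<^sup>2 / (1 + (h t)\<^sup>2)))" for t
    by (simp add: K_def \<phi>_def b_def power2_eq_square)
  have "K t * \<phi> (exp (- t)) \<ge> 0" for t
    unfolding K\<phi> by (auto intro!: mult_nonneg_nonneg divide_nonneg_nonneg add_nonneg_nonneg split: split_indicator)
  then have "AE t in lborel. K t * \<phi> (exp (- t)) = 0"
    using integral_nonneg_eq_0_iff_AE[OF i\<phi>] int0 by simp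
  then have "AE t \<in> {0<..} in lborel. h t = 0"
  proof eventually_elim
    case (elim t)
    have "1 + (h t)\<^sup>2 \<noteq> 0" using h_pos[of t] by simp
    with elim show ?case unfolding K\<phi> by (auto split: split_indicator_asm)
  qed
  then have ae: "AE t \<in> {0<..} in lebesgue. h t = 0"
    by (rule AE_completion)
  \<comment> \<open>Cutting off at \<open>t/2\<close> makes \<open>h\<close> continuous on the whole
    line without changing it near \<open>t\<close>. Its zero set is then closed, and a closed set
    containing almost every point of an open set contains all of it.\<close>
  have "t \<in> {s. h (max s (t/2)) = 0}"
  proof (rule mem_closed_if_AE_lebesgue_open[where S="{t/2<..}"])
    have "continuous_on UNIV (\<lambda>s. h (max s (t/2)))"
      using \<open>t > 0\<close> by (intro continuous_on_compose2[OF cont_h] continuous_intros) (auto simp: less_max_iff_disj)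
    then show "closed {s. h (max s (t/2)) = 0}"
      by (intro closed_Collect_eq) auto
    show "AE s \<in> {t/2<..} in lebesgue. s \<in> {s. h (max s (t/2)) = 0}"
      using ae by eventually_elim (use \<open>t > 0\<close> in \<open>auto simp: max_def\<close>)
  qed (use \<open>t > 0\<close> in auto)
  then show ?thesis using \<open>t > 0\<close> by (simp add: h_def max_def split: if_splits)
qed

subsection \<open>The theta function and its Laplace transform\<close>

text \<open>Writing \<open>q = exp (- y)\<close>, this is \<open>(-d/dy)\<^sup>p\<close> of half of \<open>\<theta>\<^sub>2(0, q)\<close>.\<close>
definition theta_half :: "nat \<Rightarrow> real \<Rightarrow> real" where
  "theta_half p y = (\<Sum>k. ((real k + 1/2)\<^sup>2) ^ p * exp (- ((real k + 1/2)\<^sup>2 * y)))"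

lemma theta_half_summable:
  assumes "y > 0"
  shows "summable (\<lambda>k. ((real k + 1/2)\<^sup>2) ^ p * exp (- ((real k + 1/2)\<^sup>2 * y)))"
proof (rule summable_comparison_test_bigo)
  show "summable (\<lambda>k. norm (1 / real k ^ 2))"
    using inverse_power_summable[of 2, where 'a=real] by (simp add: field_simps)
  show "(\<lambda>k. ((real k + 1/2)\<^sup>2) ^ p * exp (- ((real k + 1/2)\<^sup>2 * y))) \<in> O(\<lambda>k. 1 / real k ^ 2)"
    using assms by real_asymp
qed

text \<open>Termwise differentiation is justified on the half-line above \<open>y/2\<close>, where
  the values of the derived series at \<open>y/2\<close> serve as a majorant.\<close>

lemma theta_half_deriv:
  assumes y: "y > 0"
  shows "(theta_half p has_real_derivative - theta_half (Suc p) y) (at y)"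
proof -
  let ?f = "\<lambda>k y. ((real k + 1/2)\<^sup>2) ^ p * exp (- ((real k + 1/2)\<^sup>2 * y))"
  let ?f' = "\<lambda>k y. - (((real k + 1/2)\<^sup>2) ^ Suc p * exp (- ((real k + 1/2)\<^sup>2 * y)))"
  have "((\<lambda>y. \<Sum>k. ?f k y) has_real_derivative (\<Sum>k. ?f' k y)) (at y)"
  proof (rule has_field_derivative_series'(2)[where S="{y/2<..}" and x0=y])
    show "uniformly_convergent_on {y/2<..} (\<lambda>n x. \<Sum>i<n. ?f' i x)"
    proof (rule Weierstrass_m_test')
      show "summable (\<lambda>k. ((real k + 1/2)\<^sup>2) ^ Suc p * exp (- ((real k + 1/2)\<^sup>2 * (y/2))))"
        using y by (intro theta_half_summable) auto
      show "norm (?f' k x) \<le> ((real k + 1/2)\<^sup>2) ^ Suc p * exp (- ((real k + 1/2)\<^sup>2 * (y/2)))" if "x \<in> {y/2<..}" for k x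
        using that by (auto simp: abs_mult intro!: mult_left_mono)
    qed
  qed (use y theta_half_summable[OF y] in \<open>auto intro!: derivative_eq_intros simp: interior_open\<close>)
  then show ?thesis
    using theta_half_summable[OF y, of "Suc p"] by (simp add: theta_half_def[abs_def] suminf_minus)
qed

lemma theta_half_nonneg: "y > 0 \<Longrightarrow> theta_half p y \<ge> 0"
  using theta_half_summable by (auto simp: theta_half_def intro!: suminf_nonneg)

text \<open>Since \<open>k * (k + 1) + 1/4\<close> is the square of \<open>k + 1/2\<close>, the
  prefactor \<open>q powr (1/4)\<close> completes the square in every exponent.\<close>

lemma jacobi_theta2_eq_theta_half:
  assumes y: "y > 0"
  shows "jacobi_theta2 0 (exp (- y)) = 2 * theta_half 0 y"
proof -
  have "exp (- y) powr (1/4) * exp (- y) ^ (k * (k + 1)) = exp (- ((real k + 1/2)\<^sup>2 * y))" for k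
    by (simp add: powr_def exp_of_nat_mult[symmetric] exp_add[symmetric] power2_eq_square algebra_simps)
  moreover have "summable (\<lambda>k. exp (- y) ^ (k * (k + 1)))"
  proof -
    have "exp (- y) ^ (k * (k + 1)) = exp (y / 4) * exp (- ((real k + 1/2)\<^sup>2 * y))" for k
      by (simp add: exp_of_nat_mult[symmetric] exp_add[symmetric] power2_eq_square algebra_simps)
    then show ?thesis
      using summable_mult[OF theta_half_summable[OF y, of 0], of "exp (y/4)"] by simp
  qed
  ultimately have "exp (- y) powr (1/4) * (\<Sum>k. exp (- y) ^ (k * (k + 1))) = theta_half 0 y"
    unfolding theta_half_def by (subst suminf_mult[symmetric]) simp_all
  then show ?thesis
    by (simp add: jacobi_theta2_def mult.assoc)
qed

text \<open>This identifies the bracket in the density as minus the derivative in \<open>y\<close>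
  of the theta function at \<open>exp (- y)\<close>. Writing \<open>k * (k + 1)\<close> as the
  square of \<open>k + 1/2\<close> minus 1/4 turns the series into
  \<open>theta_half 1 y - theta_half 0 y / 4\<close>, up to the factor \<open>q\<close>, and the
  leading theta term cancels the correction.\<close>

lemma theta_half_1_eq:
  assumes y: "y > 0"
  defines "q \<equiv> exp (- y)"
  shows "jacobi_theta2 0 q / 4 +
      2 * q * (\<Sum>\<^sub>\<infinity>k\<in>{1::nat..}. real (k * (k + 1)) * q powr (real (k * (k + 1)) - 3/4)) = 2 * theta_half 1 y"
proof -
  let ?u = "\<lambda>k. (real k + 1/2)\<^sup>2"
  let ?t = "\<lambda>k. real (k * (k + 1)) * q powr (real (k * (k + 1)) - 3/4)"
  have t: "q * ?t k = ?u k ^ 1 * exp (- (?u k * y)) - (?u k ^ 0 * exp (- (?u k * y))) / 4" for k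
  proof -
    have "q * q powr (real (k * (k + 1)) - 3/4) = exp (- (?u k * y))"
      by (simp add: q_def powr_def exp_add[symmetric] power2_eq_square algebra_simps)
    moreover have "real (k * (k + 1)) = ?u k - 1/4"
      by (simp add: power2_eq_square algebra_simps)
    ultimately have "q * ?t k = (?u k - 1/4) * exp (- (?u k * y))"
      by (metis mult.left_commute)
    then show ?thesis
      by (simp add: left_diff_distrib)
  qed
  have "(\<lambda>k. q * ?t k) sums (theta_half 1 y - theta_half 0 y / 4)"
    unfolding t theta_half_def using theta_half_summable[OF y]
    by (intro sums_diff sums_divide summable_sums)
  from sums_mult[OF this, of "1 / q"] have "?t sums ((theta_half 1 y - theta_half 0 y / 4) / q)"
    by (simp add: q_def)
  moreover have "?t k \<ge> 0" for k by simp
  ultimately have "(?t has_sum ((theta_half 1 y - theta_half 0 y / 4) / q)) UNIV"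
    by (intro norm_summable_imp_has_sum) (auto simp: sums_iff)
  \<comment> \<open>The term at \<open>k = 0\<close> vanishes, so the sum over all naturals is also
    the sum from 1.\<close>
  then have "(?t has_sum ((theta_half 1 y - theta_half 0 y / 4) / q)) {1..}"
    by (subst has_sum_cong_neutral[where T=UNIV and g="?t"]) (auto simp: Suc_le_eq)
  then have "(\<Sum>\<^sub>\<infinity>k\<in>{1..}. ?t k) = (theta_half 1 y - theta_half 0 y / 4) / q"
    by (rule infsumI)
  then show ?thesis
    using jacobi_theta2_eq_theta_half[OF y] by (simp add: q_def)
qed

section \<open>Euler's product for sinh and csch\<close>

text \<open>Euler's product for the sine at the imaginary point \<open>\<i> * x\<close>: the squares
  change sign, both sides become purely imaginary, and imaginary parts are compared.\<close>

lemma sinh_product_formula_real: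
  fixes x :: real
  shows "(\<lambda>n. pi * x * (\<Prod>k=1..n. 1 + x\<^sup>2 / (real k)\<^sup>2)) \<longlonglongrightarrow> sinh (pi * x)"
proof -
  let ?p = "\<lambda>n. pi * x * (\<Prod>k=1..n. 1 + x\<^sup>2 / (real k)\<^sup>2)"
  have "(\<lambda>n. complex_of_real pi * (\<i> * of_real x) * (\<Prod>k=1..n. 1 - (\<i> * of_real x)\<^sup>2 / of_nat k ^ 2))
      \<longlonglongrightarrow> sin (complex_of_real pi * (\<i> * of_real x))"
    by (rule sin_product_formula_complex)
  also have "(\<lambda>n. complex_of_real pi * (\<i> * of_real x) * (\<Prod>k=1..n. 1 - (\<i> * of_real x)\<^sup>2 / of_nat k ^ 2))
      = (\<lambda>n. \<i> * of_real (?p n))"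
    by (simp add: power_mult_distrib mult_ac)
  also have "sin (complex_of_real pi * (\<i> * of_real x)) = \<i> * of_real (sinh (pi * x))"
  proof -
    have "sinh (complex_of_real (pi * x)) = of_real (sinh (pi * x))"
      by (simp add: sinh_def scaleR_conv_of_real exp_of_real[symmetric])
    then have "- (\<i> * sin (complex_of_real pi * (\<i> * of_real x))) = of_real (sinh (pi * x))"
      by (simp add: sinh_conv_sin mult_ac)
    then have "\<i> * (- (\<i> * sin (complex_of_real pi * (\<i> * of_real x)))) = \<i> * of_real (sinh (pi * x))"
      by simp
    then show ?thesis
      by (simp add: mult.assoc[symmetric])
  qed
  finally have "(\<lambda>n. Im (\<i> * of_real (?p n))) \<longlonglongrightarrow> Im (\<i> * of_real (sinh (pi * x)))"
    by (rule tendsto_Im)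
  then show ?thesis
    by (simp only: Im_i_times Re_complex_of_real)
qed

lemma csch_product:
  fixes a :: real
  assumes "a > 0"
  shows "(\<lambda>n. \<Prod>k=1..n. 1 / (1 + a / (real k)\<^sup>2)) \<longlonglongrightarrow> sqrt a * pi * csch (sqrt a * pi)"
proof -
  have "(\<lambda>n. pi * sqrt a / (pi * sqrt a * (\<Prod>k=1..n. 1 + (sqrt a)\<^sup>2 / (real k)\<^sup>2))) \<longlonglongrightarrow> pi * sqrt a / sinh (pi * sqrt a)"
    using assms by (intro tendsto_intros sinh_product_formula_real) auto
  then show ?thesis
    using assms by (simp add: csch_def prod_dividef mult_ac)
qed

section \<open>The theta expressions for the distribution function and the density\<close>

definition theta_cdf :: "real \<Rightarrow> real \<Rightarrow> real" where
  "theta_cdf m t = sqrt (m * pi / t) * (2 * theta_half 0 (m * pi\<^sup>2 / t))"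

definition theta_density :: "real \<Rightarrow> real \<Rightarrow> real" where
  "theta_density m x = sqrt (m * pi) / (2 * x powr (5/2)) *
     (2 * m * pi\<^sup>2 * (2 * theta_half 1 (m * pi\<^sup>2 / x)) - x * (2 * theta_half 0 (m * pi\<^sup>2 / x)))"

text \<open>Product rule: the chain rule through \<open>m * pi\<^sup>2 / x\<close> produces the
  \<open>theta_half 1\<close> term, and the derivative of \<open>1 / sqrt x\<close> produces the
  subtracted one.\<close>

lemma theta_cdf_deriv:
  assumes "m > 0" "x > 0"
  shows "(theta_cdf m has_real_derivative theta_density m x) (at x)"
proof -
  let ?y = "m * pi\<^sup>2 / x"
  have y: "?y > 0" using assms by simp
  have "((\<lambda>t. sqrt (m * pi) / sqrt t * (2 * theta_half 0 (m * pi\<^sup>2 / t))) has_real_derivative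
     (sqrt (m * pi) / sqrt x * (2 * (- theta_half 1 ?y * (- (m * pi\<^sup>2) / x\<^sup>2)))
      + (- sqrt (m * pi) / (2 * x * sqrt x)) * (2 * theta_half 0 ?y))) (at x)"
    using assms theta_half_deriv[OF y, of 0]
    by (auto intro!: derivative_eq_intros DERIV_chain2[where f="theta_half 0"] simp: power2_eq_square field_simps)
  also have "x powr (5/2) = x\<^sup>2 * sqrt x"
    using assms powr_add[of x 2 "1/2"] by (simp add: powr_half_sqrt)
  then have "(sqrt (m * pi) / sqrt x * (2 * (- theta_half 1 ?y * (- (m * pi\<^sup>2) / x\<^sup>2)))
      + (- sqrt (m * pi) / (2 * x * sqrt x)) * (2 * theta_half 0 ?y)) = theta_density m x"
    using assms by (simp add: theta_density_def field_simps power2_eq_square)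
  finally show ?thesis
    by (simp add: theta_cdf_def[abs_def] real_sqrt_divide)
qed

lemma isCont_theta_density:
  assumes "m > 0" "x > 0"
  shows "isCont (theta_density m) x"
proof -
  have c: "isCont (\<lambda>x. theta_half p (m * pi\<^sup>2 / x)) x" for p
  proof -
    have "isCont (theta_half p) (m * pi\<^sup>2 / x)"
      using assms by (intro DERIV_isCont[OF theta_half_deriv]) auto
    moreover have "isCont (\<lambda>x. m * pi\<^sup>2 / x) x"
      using assms by (intro continuous_intros) auto
    ultimately show ?thesis by (rule isCont_o2[rotated])
  qed
  show ?thesis
    unfolding theta_density_def using assms by (intro continuous_intros c) auto
qed

lemma theta_cdf_nonneg: "m > 0 \<Longrightarrow> t > 0 \<Longrightarrow> theta_cdf m t \<ge> 0"
  by (simp add: theta_cdf_def theta_half_nonneg)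

lemma borel_measurable_theta_half [measurable]: "theta_half p \<in> borel_measurable borel"
  unfolding theta_half_def[abs_def] by measurable

lemma borel_measurable_theta_density [measurable]: "theta_density m \<in> borel_measurable borel"
  unfolding theta_density_def[abs_def] by measurable

text \<open>All terms are nonnegative, so sum and integral commute, and each term is an instance of
  \<open>nn_integral_inverse_sqrt_exp\<close>. The results form a geometric series, summed by
  \<open>exp (- x) / (1 - exp (- 2 * x)) = 1 / (2 * sinh x)\<close> with
  \<open>x = sqrt (\<alpha> * m) * pi\<close>.\<close>

lemma theta_cdf_laplace:
  assumes m: "m > 0" and \<alpha>: "\<alpha> > 0"
  shows "(\<integral>\<^sup>+ t. ennreal (exp (- (\<alpha> * t)) * theta_cdf m t) * indicator {0<..} t \<partial>lborel)
    = ennreal (sqrt (\<alpha> * m) * pi * csch (sqrt (\<alpha> * m) * pi) / \<alpha>)"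
proof -
  let ?c = "\<lambda>k. (real k + 1/2)\<^sup>2 * (m * pi\<^sup>2)"
  let ?f = "\<lambda>k t. ennreal (2 * sqrt (m * pi)) * (ennreal (exp (- \<alpha> * t - ?c k / t) / sqrt t) * indicator {0<..} t)"
  define r where "r = exp (- 2 * (sqrt (\<alpha> * m) * pi))"
  have "(\<integral>\<^sup>+ t. ennreal (exp (- (\<alpha> * t)) * theta_cdf m t) * indicator {0<..} t \<partial>lborel)
      = (\<integral>\<^sup>+ t. (\<Sum>k. ?f k t) \<partial>lborel)"
  proof (intro nn_integral_cong)
    fix t :: real
    show "ennreal (exp (- (\<alpha> * t)) * theta_cdf m t) * indicator {0<..} t = (\<Sum>k. ?f k t)"
    proof (cases "t > 0")
      case True
      let ?g = "\<lambda>k. 2 * sqrt (m * pi) * (exp (- \<alpha> * t - ?c k / t) / sqrt t)"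
      have "?g = (\<lambda>k. (2 * sqrt (m * pi) * exp (- \<alpha> * t) / sqrt t)
          * (((real k + 1/2)\<^sup>2) ^ 0 * exp (- ((real k + 1/2)\<^sup>2 * (m * pi\<^sup>2 / t)))))"
        by (simp add: exp_diff exp_minus field_simps)
      moreover have "\<dots> sums ((2 * sqrt (m * pi) * exp (- \<alpha> * t) / sqrt t) * theta_half 0 (m * pi\<^sup>2 / t))"
        unfolding theta_half_def using True m
        by (intro sums_mult summable_sums theta_half_summable) auto
      moreover have "(2 * sqrt (m * pi) * exp (- \<alpha> * t) / sqrt t) * theta_half 0 (m * pi\<^sup>2 / t) = exp (- (\<alpha> * t)) * theta_cdf m t"
        by (simp add: theta_cdf_def real_sqrt_divide)
      ultimately have "?g sums (exp (- (\<alpha> * t)) * theta_cdf m t)" by simp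
      then have "(\<lambda>k. ennreal (?g k)) sums ennreal (exp (- (\<alpha> * t)) * theta_cdf m t)"
        using True m theta_cdf_nonneg[OF m True] by (subst sums_ennreal) auto
      moreover have "?f k t = ennreal (?g k)" for k
        using True m by (simp add: ennreal_mult'[symmetric] del: ennreal_mult'')
      ultimately show ?thesis
        using True by (simp only: sums_iff) simp
    qed simp
  qed
  also have "\<dots> = (\<Sum>k. \<integral>\<^sup>+ t. ?f k t \<partial>lborel)"
    by (intro nn_integral_suminf) measurable
  also have "(\<lambda>k. \<integral>\<^sup>+ t. ?f k t \<partial>lborel) = (\<lambda>k. ennreal (2 * sqrt (m * pi) * (sqrt (pi / \<alpha>) * exp (- (sqrt (\<alpha> * m) * pi))) * r ^ k))"
  proof
    fix k
    \<comment> \<open>The exponents of the theta series are quadratic in \<open>k\<close>; the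
      square root makes them linear, hence the ratio \<open>r\<close>.\<close>
    have "sqrt (\<alpha> * ?c k) = sqrt (\<alpha> * m) * pi * (real k + 1/2)"
      by (simp add: real_sqrt_mult)
    then have e: "exp (- 2 * sqrt (\<alpha> * ?c k)) = exp (- (sqrt (\<alpha> * m) * pi)) * r ^ k"
      by (simp add: r_def exp_of_nat_mult[symmetric] exp_add[symmetric] algebra_simps)
    have "(\<integral>\<^sup>+ t. ?f k t \<partial>lborel) = ennreal (2 * sqrt (m * pi))
        * (\<integral>\<^sup>+ t. ennreal (exp (- \<alpha> * t - ?c k / t) / sqrt t) * indicator {0<..} t \<partial>lborel)"
      by (rule nn_integral_cmult) measurable
    also have "\<dots> = ennreal (2 * sqrt (m * pi)) * ennreal (sqrt (pi / \<alpha>) * exp (- 2 * sqrt (\<alpha> * ?c k)))"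
      using m \<alpha> by (subst nn_integral_inverse_sqrt_exp) auto
    finally have "(\<integral>\<^sup>+ t. ?f k t \<partial>lborel) = ennreal (2 * sqrt (m * pi)) * ennreal (sqrt (pi / \<alpha>) * exp (- 2 * sqrt (\<alpha> * ?c k)))" .
    then show "(\<integral>\<^sup>+ t. ?f k t \<partial>lborel) = ennreal (2 * sqrt (m * pi) * (sqrt (pi / \<alpha>) * exp (- (sqrt (\<alpha> * m) * pi))) * r ^ k)"
      unfolding e using m by (simp add: ennreal_mult'[symmetric] mult_ac)
  qed
  also have "(\<Sum>k. ennreal (2 * sqrt (m * pi) * (sqrt (pi / \<alpha>) * exp (- (sqrt (\<alpha> * m) * pi))) * r ^ k))
      = ennreal (2 * sqrt (m * pi) * (sqrt (pi / \<alpha>) * exp (- (sqrt (\<alpha> * m) * pi))) * (1 / (1 - r)))"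
  proof -
    have r: "0 < r" "r < 1" using m \<alpha> by (auto simp: r_def)
    have "(\<lambda>k. 2 * sqrt (m * pi) * (sqrt (pi / \<alpha>) * exp (- (sqrt (\<alpha> * m) * pi))) * r ^ k) sums
       (2 * sqrt (m * pi) * (sqrt (pi / \<alpha>) * exp (- (sqrt (\<alpha> * m) * pi))) * (1 / (1 - r)))"
      using r by (intro sums_mult geometric_sums) auto
    then have "(\<lambda>k. ennreal (2 * sqrt (m * pi) * (sqrt (pi / \<alpha>) * exp (- (sqrt (\<alpha> * m) * pi))) * r ^ k)) sums
       ennreal (2 * sqrt (m * pi) * (sqrt (pi / \<alpha>) * exp (- (sqrt (\<alpha> * m) * pi))) * (1 / (1 - r)))"
      using m \<alpha> r by (subst sums_ennreal) auto
    then show ?thesis by (rule sums_unique[symmetric])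
  qed
  also have "2 * sqrt (m * pi) * (sqrt (pi / \<alpha>) * exp (- (sqrt (\<alpha> * m) * pi))) * (1 / (1 - r))
      = sqrt (\<alpha> * m) * pi * csch (sqrt (\<alpha> * m) * pi) / \<alpha>"
  proof -
    define x where "x = sqrt (\<alpha> * m) * pi"
    have x: "x > 0" using m \<alpha> by (simp add: x_def)
    have "exp (- x) * (1 / (1 - exp (- 2 * x))) = 1 / (exp x * (1 - exp (- 2 * x)))"
      by (simp add: exp_minus field_simps)
    also have "exp x * (1 - exp (- 2 * x)) = 2 * sinh x"
      by (simp add: sinh_field_def right_diff_distrib exp_add[symmetric])
    finally have e1: "exp (- x) * (1 / (1 - r)) = csch x / 2"
      by (simp add: r_def x_def csch_def)
    have e2: "sqrt (m * pi) * sqrt (pi / \<alpha>) = x / \<alpha>"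
      using m \<alpha> by (simp add: x_def real_sqrt_mult real_sqrt_divide field_simps)
    have "2 * sqrt (m * pi) * (sqrt (pi / \<alpha>) * exp (- x)) * (1 / (1 - r))
        = 2 * (sqrt (m * pi) * sqrt (pi / \<alpha>)) * (exp (- x) * (1 / (1 - r)))"
      by (simp only: mult_ac)
    also have "\<dots> = x * csch x / \<alpha>"
      unfolding e1 e2 by simp
    finally show ?thesis
      unfolding x_def .
  qed
  finally show ?thesis .
qed

subsection \<open>The weighted sum of exponential variables\<close>

text \<open>Conditionally on \<open>Y = y\<close> the event says that \<open>X\<close> hits the
  single point \<open>c - y\<close>, which has probability zero because \<open>X\<close> has a
  density.\<close>

lemma (in prob_space) prob_add_indep_eq_0:
  fixes X Y :: "'a \<Rightarrow> real"
  assumes indep: "indep_var borel X borel Y"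
    and X: "distributed M lborel X f"
  shows "prob {\<omega> \<in> space M. X \<omega> + Y \<omega> = c} = 0"
proof -
  have [measurable]: "X \<in> borel_measurable M" "Y \<in> borel_measurable M"
    using indep_var_rv1[OF indep] indep_var_rv2[OF indep] .
  have "distr M borel (\<lambda>\<omega>. X \<omega> + Y \<omega>) = convolution (distr M borel X) (distr M borel Y)"
    using indep by (rule sum_indep_random_variable) auto
  \<comment> \<open>The order is swapped so that the law of \<open>X\<close> becomes the inner
    measure in \<open>convolution_emeasure\<close>.\<close>
  also have "\<dots> = convolution (distr M borel Y) (distr M borel X)"
    by (intro convolution_commutative finite_measure_distr) auto
  finally have eq: "distr M borel (\<lambda>\<omega>. X \<omega> + Y \<omega>) = convolution (distr M borel Y) (distr M borel X)" .
  have null: "emeasure (distr M borel X) {x} = 0" for x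
  proof -
    have "emeasure (distr M borel X) {x} = emeasure (distr M lborel X) {x}"
      by (simp add: emeasure_distr)
    also have "\<dots> = emeasure (density lborel f) {x}"
      by (simp add: distributed_distr_eq_density[OF X])
    also have "\<dots> = 0"
      using distributed_borel_measurable[OF X] AE_lborel_singleton[of x]
      by (subst emeasure_density) (auto simp: nn_integral_0_iff_AE elim!: eventually_mono split: split_indicator)
    finally show ?thesis .
  qed
  have "emeasure M {\<omega> \<in> space M. X \<omega> + Y \<omega> = c} = emeasure (distr M borel (\<lambda>\<omega>. X \<omega> + Y \<omega>)) {c}"
    by (subst emeasure_distr) (auto intro!: arg_cong2[where f=emeasure])
  also have "\<dots> = (\<integral>\<^sup>+ y. emeasure (distr M borel X) {x. x + y \<in> {c}} \<partial>distr M borel Y)"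
    unfolding eq by (rule convolution_emeasure) (auto simp: finite_measure_distr)
  also have "\<dots> = (\<integral>\<^sup>+ y. emeasure (distr M borel X) {c - y} \<partial>distr M borel Y)"
    by (intro nn_integral_cong arg_cong2[where f=emeasure]) auto
  finally show ?thesis
    by (simp add: null measure_def)
qed

text \<open>Mean \<open>m\<close> is encoded as rate \<open>1 / m\<close>. Since \<open>W 0\<close>
  is unconstrained, series over the weights are indexed through \<open>Suc\<close>.\<close>

locale exponential_weights = prob_space M for M :: "'a measure" +
  fixes m :: real and W :: "nat \<Rightarrow> 'a \<Rightarrow> real"
  assumes m: "m > 0"
    and W_indep: "indep_vars (\<lambda>_. borel) W {1..}"
    and W_exp: "\<And>k. k \<ge> 1 \<Longrightarrow> distributed M lborel (W k) (exponential_density (1 / m))"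
begin

lemma W_measurable: "k \<ge> 1 \<Longrightarrow> W k \<in> borel_measurable M"
  using distributed_measurable[OF W_exp] by simp

lemma W_Suc_measurable [measurable]: "W (Suc k) \<in> borel_measurable M"
  by (rule W_measurable) simp

lemma W_nonneg: "AE \<omega> in M. \<forall>k\<ge>1. W k \<omega> \<ge> 0"
proof -
  have "AE \<omega> in M. W k \<omega> \<ge> 0" if k: "k \<ge> 1" for k
  proof -
    have "AE x in lborel. 0 < ennreal (exponential_density (1 / m) x) \<longrightarrow> x \<ge> 0"
      by (auto simp: exponential_density_def)
    then show ?thesis
      using distributed_AE2[OF W_exp[OF k], of "\<lambda>x. x \<ge> 0"] by simp
  qed
  then show ?thesis
    by (subst AE_all_countable) auto
qed

lemma nn_integral_W:
  assumes "k \<ge> 1"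
  shows "(\<integral>\<^sup>+ \<omega>. ennreal (W k \<omega>) \<partial>M) = ennreal m"
proof -
  have "(\<integral>\<^sup>+ \<omega>. ennreal (W k \<omega>) \<partial>M)
      = (\<integral>\<^sup>+ x. ennreal (exponential_density (1 / m) x) * ennreal x \<partial>lborel)"
    using distributed_nn_integral[OF W_exp[OF assms], of ennreal] by simp
  also have "\<dots> = (\<integral>\<^sup>+ x. ennreal (exponential_density (1 / m) x * x ^ 1) \<partial>lborel)"
    using m by (intro nn_integral_cong) (simp add: ennreal_mult'[symmetric] exponential_density_nonneg)
  also have "\<dots> = ennreal m"
    using m by (subst nn_integral_erlang_ith_moment) auto
  finally show ?thesis .
qed

text \<open>Exponential tilting: multiplying the density of rate \<open>l\<close> by
  \<open>exp (- (s * x))\<close> gives \<open>l / (l + s)\<close> times the density of rate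
  \<open>l + s\<close>, whose total mass is 1.\<close>

lemma expectation_exp_W:
  assumes "k \<ge> 1" "s \<ge> 0"
  shows "expectation (\<lambda>\<omega>. exp (- (s * W k \<omega>))) = 1 / (1 + s * m)"
proof -
  let ?l = "1 / m"
  have l: "?l > 0" using m by simp
  have "(\<integral>\<^sup>+ \<omega>. ennreal (exp (- (s * W k \<omega>))) \<partial>M)
      = (\<integral>\<^sup>+ x. ennreal (exponential_density ?l x) * ennreal (exp (- (s * x))) \<partial>lborel)"
    using distributed_nn_integral[OF W_exp[OF assms(1)], of "\<lambda>x. ennreal (exp (- (s * x)))"] by simp
  \<comment> \<open>The factor \<open>x ^ 0\<close> presents the total mass as a zeroth moment, in
    the form of the Erlang moment formula.\<close>
  also have "\<dots> = (\<integral>\<^sup>+ x. ennreal (?l / (?l + s)) * ennreal (exponential_density (?l + s) x * x ^ 0) \<partial>lborel)"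
  proof (intro nn_integral_cong)
    fix x
    have "exponential_density ?l x * exp (- (s * x)) = ?l / (?l + s) * exponential_density (?l + s) x"
    proof (cases "x < 0")
      case False
      have "?l + s \<noteq> 0" using l assms by linarith
      moreover have "exp (- x * (?l + s)) = exp (- x * ?l) * exp (- (s * x))"
        by (simp add: exp_add[symmetric] algebra_simps)
      ultimately show ?thesis
        using False by (simp add: exponential_density_def)
    qed (simp add: exponential_density_def)
    then show "ennreal (exponential_density ?l x) * ennreal (exp (- (s * x)))
        = ennreal (?l / (?l + s)) * ennreal (exponential_density (?l + s) x * x ^ 0)"
      using l assms by (simp add: ennreal_mult'[symmetric] exponential_density_nonneg)
  qed
  also have "\<dots> = ennreal (?l / (?l + s)) * (\<integral>\<^sup>+ x. ennreal (exponential_density (?l + s) x * x ^ 0) \<partial>lborel)"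
    by (rule nn_integral_cmult) measurable
  also have "\<dots> = ennreal (?l / (?l + s))"
    using l assms by (subst nn_integral_erlang_ith_moment) (auto simp: add_pos_nonneg)
  finally have "expectation (\<lambda>\<omega>. exp (- (s * W k \<omega>))) = ?l / (?l + s)"
    using l assms W_measurable[OF assms(1)] by (subst integral_eq_nn_integral) auto
  also have "\<dots> = 1 / (1 + s * m)"
    using m by (simp add: field_simps)
  finally show ?thesis .
qed

section \<open>The weighted sum, its Laplace transform and its lack of atoms\<close>

text \<open>Taken in \<open>ennreal\<close>, the series converges at every sample point and agrees
  there with the nonnegative integral against the random measure, even where a weight is
  negative.\<close>

definition weighted_total :: "'a \<Rightarrow> ennreal" where
  "weighted_total \<omega> = (\<Sum>k. ennreal (W (Suc k) \<omega>) * ennreal (1 / (real (Suc k))\<^sup>2))"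

text \<open>\<open>enn2real\<close> sends infinity to 0, as the Bochner integral does for a
  nonnegative measurable function that is not integrable. This makes the later identity with
  \<open>Nf\<close> hold at every sample point.\<close>

definition S :: "'a \<Rightarrow> real" where
  "S \<omega> = enn2real (weighted_total \<omega>)"

lemma S_measurable [measurable]: "S \<in> borel_measurable M"
  unfolding S_def[abs_def] weighted_total_def[abs_def] by measurable

lemma S_nonneg: "S \<omega> \<ge> 0"
  by (simp add: S_def)

text \<open>The expectation is \<open>m\<close> times the sum of the inverse squares, hence
  finite.\<close>

lemma weighted_total_finite: "AE \<omega> in M. weighted_total \<omega> \<noteq> \<infinity>"
proof (rule nn_integral_PInf_AE)
  show "weighted_total \<in> borel_measurable M"
    unfolding weighted_total_def[abs_def] by measurable
  have "(\<integral>\<^sup>+ \<omega>. weighted_total \<omega> \<partial>M)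
      = (\<Sum>k. \<integral>\<^sup>+ \<omega>. ennreal (W (Suc k) \<omega>) * ennreal (1 / (real (Suc k))\<^sup>2) \<partial>M)"
    unfolding weighted_total_def by (intro nn_integral_suminf) measurable
  also have "\<dots> = (\<Sum>k. ennreal (m * (1 / (real (Suc k))\<^sup>2)))"
    using m by (intro suminf_cong) (simp add: nn_integral_multc nn_integral_W ennreal_mult'[symmetric])
  also have "\<dots> = ennreal (\<Sum>k. m * (1 / (real (Suc k))\<^sup>2))"
    using m inverse_squares_sums
    by (intro suminf_ennreal2 summable_mult) (auto simp: sums_iff add.commute)
  finally show "(\<integral>\<^sup>+ \<omega>. weighted_total \<omega> \<partial>M) \<noteq> \<infinity>" by simp
qed

lemma S_sums: "AE \<omega> in M. (\<lambda>k. W (Suc k) \<omega> / (real (Suc k))\<^sup>2) sums S \<omega>"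
  using weighted_total_finite W_nonneg
proof eventually_elim
  case (elim \<omega>)
  have "(\<lambda>k. ennreal (W (Suc k) \<omega>) * ennreal (1 / (real (Suc k))\<^sup>2)) sums weighted_total \<omega>"
    unfolding weighted_total_def by (intro summable_sums summableI)
  also have "(\<lambda>k. ennreal (W (Suc k) \<omega>) * ennreal (1 / (real (Suc k))\<^sup>2)) = (\<lambda>k. ennreal (W (Suc k) \<omega> / (real (Suc k))\<^sup>2))"
    using elim by (auto simp: ennreal_mult'[symmetric])
  also have "weighted_total \<omega> = ennreal (S \<omega>)"
    using elim by (simp add: S_def less_top)
  finally show ?case
    using elim S_nonneg by (subst (asm) sums_ennreal) auto
qed

text \<open>The exponentials of the partial sums are almost surely bounded by 1, so dominated
  convergence applies; independence factors their expectations into the partial products of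
  \<open>csch_product\<close>.\<close>

lemma expectation_exp_S:
  assumes \<alpha>: "\<alpha> > 0"
  shows "expectation (\<lambda>\<omega>. exp (- (\<alpha> * S \<omega>))) = sqrt (\<alpha> * m) * pi * csch (sqrt (\<alpha> * m) * pi)"
proof -
  let ?P = "\<lambda>n \<omega>. \<Prod>k=1..n. exp (- (\<alpha> / (real k)\<^sup>2 * W k \<omega>))"
  have P: "?P n \<omega> = exp (- (\<alpha> * (\<Sum>k<n. W (Suc k) \<omega> / (real (Suc k))\<^sup>2)))" for n \<omega>
    by (induction n) (auto simp: exp_add[symmetric] algebra_simps)
  have meas: "?P n \<in> borel_measurable M" for n
    unfolding P by measurable
  have "(\<lambda>n. expectation (?P n)) \<longlonglongrightarrow> expectation (\<lambda>\<omega>. exp (- (\<alpha> * S \<omega>)))"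
  proof (rule integral_dominated_convergence[where w="\<lambda>_. 1"])
    show "AE \<omega> in M. (\<lambda>n. ?P n \<omega>) \<longlonglongrightarrow> exp (- (\<alpha> * S \<omega>))"
      unfolding P using S_sums by eventually_elim (auto simp: sums_def intro!: tendsto_intros)
    show "AE \<omega> in M. norm (?P n \<omega>) \<le> 1" for n
      using W_nonneg
    proof eventually_elim
      case (elim \<omega>)
      then have "(\<Sum>k<n. W (Suc k) \<omega> / (real (Suc k))\<^sup>2) \<ge> 0"
        by (intro sum_nonneg) auto
      then show ?case unfolding P using \<alpha> by simp
    qed
  qed (use meas in auto)
  moreover have "expectation (?P n) = (\<Prod>k=1..n. 1 / (1 + \<alpha> * m / (real k)\<^sup>2))" for n
  proof -
    have int: "integrable M (\<lambda>\<omega>. exp (- (\<alpha> / (real k)\<^sup>2 * W k \<omega>)))" if "k \<in> {1..n}" for k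
    proof (rule integrable_const_bound[where B=1])
      show "AE \<omega> in M. norm (exp (- (\<alpha> / (real k)\<^sup>2 * W k \<omega>))) \<le> 1"
        using W_nonneg by eventually_elim (use that \<alpha> in auto)
    qed (use that W_measurable[of k] in auto)
    have "indep_vars (\<lambda>_. borel) (\<lambda>k \<omega>. exp (- (\<alpha> / (real k)\<^sup>2 * W k \<omega>))) {1..n}"
      by (rule indep_vars_compose2[OF indep_vars_subset[OF W_indep]]) auto
    then have "expectation (?P n) = (\<Prod>k=1..n. expectation (\<lambda>\<omega>. exp (- (\<alpha> / (real k)\<^sup>2 * W k \<omega>))))"
      using int by (intro indep_vars_lebesgue_integral) auto
    also have "\<dots> = (\<Prod>k=1..n. 1 / (1 + \<alpha> * m / (real k)\<^sup>2))"
      using \<alpha> by (intro prod.cong refl, subst expectation_exp_W) auto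
    finally show ?thesis .
  qed
  ultimately have "(\<lambda>n. \<Prod>k=1..n. 1 / (1 + \<alpha> * m / (real k)\<^sup>2)) \<longlonglongrightarrow> expectation (\<lambda>\<omega>. exp (- (\<alpha> * S \<omega>)))"
    by simp
  then show ?thesis
    using csch_product[of "\<alpha> * m"] \<alpha> m by (auto intro: LIMSEQ_unique)
qed

text \<open>Splitting off \<open>W 1\<close> leaves a remainder that depends only on the weights
  from index 2 on. It is independent of \<open>W 1\<close>, so \<open>prob_add_indep_eq_0\<close>
  applies.\<close>

lemma prob_S_eq: "prob {\<omega> \<in> space M. S \<omega> = c} = 0"
proof -
  let ?R = "\<lambda>f :: nat \<Rightarrow> real. \<Sum>k. f (Suc (Suc k)) / (real (Suc (Suc k)))\<^sup>2"
  have "indep_var (PiM {1} (\<lambda>_. borel)) (\<lambda>\<omega>. restrict (\<lambda>k. W k \<omega>) {1}) (PiM {2..} (\<lambda>_. borel)) (\<lambda>\<omega>. restrict (\<lambda>k. W k \<omega>) {2..})"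
    by (rule indep_var_restrict[OF W_indep]) auto
  then have "indep_var borel ((\<lambda>f. f 1) \<circ> (\<lambda>\<omega>. restrict (\<lambda>k. W k \<omega>) {1})) borel (?R \<circ> (\<lambda>\<omega>. restrict (\<lambda>k. W k \<omega>) {2..}))"
  proof (rule indep_var_compose)
    show "(\<lambda>f. f 1) \<in> borel_measurable (Pi\<^sub>M {1::nat} (\<lambda>_. borel :: real measure))"
      by (rule measurable_component_singleton) auto
    have [measurable]: "(\<lambda>f. f (Suc (Suc k))) \<in> borel_measurable (Pi\<^sub>M {2::nat..} (\<lambda>_. borel :: real measure))" for k
      by (rule measurable_component_singleton) auto
    show "?R \<in> borel_measurable (Pi\<^sub>M {2::nat..} (\<lambda>_. borel :: real measure))"
      by measurable
  qed
  then have "indep_var borel (W 1) borel (\<lambda>\<omega>. ?R (\<lambda>k. W k \<omega>))"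
    by (simp add: comp_def)
  then have "prob {\<omega> \<in> space M. W 1 \<omega> + ?R (\<lambda>k. W k \<omega>) = c} = 0"
    by (rule prob_add_indep_eq_0) (rule W_exp, simp)
  also have "prob {\<omega> \<in> space M. W 1 \<omega> + ?R (\<lambda>k. W k \<omega>) = c} = prob {\<omega> \<in> space M. S \<omega> = c}"
  proof (rule finite_measure_eq_AE)
    \<comment> \<open>The real series \<open>?R\<close> is meaningful only where it converges, so
      the decomposition is claimed almost everywhere.\<close>
    have "AE \<omega> in M. S \<omega> = W 1 \<omega> + ?R (\<lambda>k. W k \<omega>)"
      using S_sums
    proof eventually_elim
      case (elim \<omega>)
      then have "(\<lambda>k. W (Suc (Suc k)) \<omega> / (real (Suc (Suc k)))\<^sup>2) sums (S \<omega> - W 1 \<omega>)"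
        by (subst sums_Suc_iff) simp
      from sums_unique[OF this] show ?case by simp
    qed
    then show "AE \<omega> in M. (\<omega> \<in> {\<omega> \<in> space M. W 1 \<omega> + ?R (\<lambda>k. W k \<omega>) = c}) = (\<omega> \<in> {\<omega> \<in> space M. S \<omega> = c})"
      by eventually_elim auto
    have [measurable]: "W 1 \<in> borel_measurable M" by (rule W_measurable) simp
    show "{\<omega> \<in> space M. W 1 \<omega> + ?R (\<lambda>k. W k \<omega>) = c} \<in> events" "{\<omega> \<in> space M. S \<omega> = c} \<in> events"
      by measurable
  qed
  finally show ?thesis .
qed

section \<open>The distribution function and the density of the sum\<close>

definition F :: "real \<Rightarrow> real" where
  "F t = prob {\<omega> \<in> space M. S \<omega> \<le> t}"

lemma F_eq_cdf: "F = cdf (distr M borel S)"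
  by (auto simp: F_def cdf_def measure_distr vimage_def Int_def conj_commute)

lemma F_isCont: "isCont F t"
proof -
  interpret D: real_distribution "distr M borel S"
    by (rule real_distribution_distr) measurable
  have "measure (distr M borel S) {t} = prob {\<omega> \<in> space M. S \<omega> = t}"
    by (auto simp: measure_distr intro!: arg_cong[where f=prob])
  then show ?thesis
    unfolding F_eq_cdf D.isCont_cdf by (simp add: prob_S_eq)
qed

lemma F_mono: "s \<le> t \<Longrightarrow> F s \<le> F t"
  unfolding F_def by (intro finite_measure_mono) auto

text \<open>The value at \<open>t = 0\<close> rests on the absence of an atom there.\<close>

lemma F_nonpos:
  assumes "t \<le> 0"
  shows "F t = 0"
proof -
  have "{\<omega> \<in> space M. S \<omega> \<le> t} \<subseteq> {\<omega> \<in> space M. S \<omega> = 0}"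
    using S_nonneg assms by (auto intro: antisym order_trans)
  then have "F t \<le> prob {\<omega> \<in> space M. S \<omega> = 0}"
    unfolding F_def by (intro finite_measure_mono) auto
  then show ?thesis
    by (simp add: prob_S_eq F_def measure_le_0_iff)
qed

text \<open>Writing \<open>F t\<close> as the expectation of the indicator of
  \<open>S \<le> t\<close> and exchanging the integrals leaves the integral of
  \<open>exp (- (\<alpha> * t))\<close> over \<open>t \<ge> S\<close>, which is
  \<open>exp (- (\<alpha> * S)) / \<alpha>\<close>.\<close>

lemma F_laplace:
  assumes \<alpha>: "\<alpha> > 0"
  shows "(\<integral>\<^sup>+ t. ennreal (exp (- (\<alpha> * t)) * F t) * indicator {0<..} t \<partial>lborel)
    = ennreal (sqrt (\<alpha> * m) * pi * csch (sqrt (\<alpha> * m) * pi) / \<alpha>)"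
proof -
  interpret P: pair_sigma_finite M lborel
    by unfold_locales
  let ?f = "\<lambda>\<omega> t. ennreal (exp (- (\<alpha> * t))) * indicator {0<..} t * indicator {S \<omega>..} t"
  have "(\<integral>\<^sup>+ t. ennreal (exp (- (\<alpha> * t)) * F t) * indicator {0<..} t \<partial>lborel) = (\<integral>\<^sup>+ t. (\<integral>\<^sup>+ \<omega>. ?f \<omega> t \<partial>M) \<partial>lborel)"
  proof (intro nn_integral_cong)
    fix t
    have "(\<integral>\<^sup>+ \<omega>. ?f \<omega> t \<partial>M) = (\<integral>\<^sup>+ \<omega>. ennreal (exp (- (\<alpha> * t))) * indicator {0<..} t * indicator {\<omega> \<in> space M. S \<omega> \<le> t} \<omega> \<partial>M)"
      by (intro nn_integral_cong) (auto split: split_indicator)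
    also have "\<dots> = ennreal (exp (- (\<alpha> * t))) * indicator {0<..} t * emeasure M {\<omega> \<in> space M. S \<omega> \<le> t}"
      by (intro nn_integral_cmult_indicator) measurable
    finally show "ennreal (exp (- (\<alpha> * t)) * F t) * indicator {0<..} t = (\<integral>\<^sup>+ \<omega>. ?f \<omega> t \<partial>M)"
      by (simp add: F_def emeasure_eq_measure ennreal_mult mult_ac)
  qed
  also have "\<dots> = (\<integral>\<^sup>+ \<omega>. (\<integral>\<^sup>+ t. ?f \<omega> t \<partial>lborel) \<partial>M)"
  proof (rule P.Fubini')
    have "(\<lambda>(\<omega>, t). ?f \<omega> t) = (\<lambda>p. ennreal (exp (- (\<alpha> * snd p))) * indicator {0<..} (snd p) * indicator {p. S (fst p) \<le> snd p} p)"
      by (auto simp: fun_eq_iff split: split_indicator)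
    also have "\<dots> \<in> borel_measurable (M \<Otimes>\<^sub>M lborel)"
    proof -
      have "(\<lambda>p. indicator {p. S (fst p) \<le> snd p} p :: ennreal) \<in> borel_measurable (M \<Otimes>\<^sub>M lborel)"
        by (rule borel_measurable_indicator') measurable
      then show ?thesis by measurable
    qed
    finally show "(\<lambda>(\<omega>, t). ?f \<omega> t) \<in> borel_measurable (M \<Otimes>\<^sub>M lborel)" .
  qed
  also have "\<dots> = (\<integral>\<^sup>+ \<omega>. ennreal (exp (- (\<alpha> * S \<omega>)) / \<alpha>) \<partial>M)"
  proof (intro nn_integral_cong)
    fix \<omega>
    \<comment> \<open>As \<open>S\<close> is nonnegative, dropping the restriction to positive
      \<open>t\<close> adds at most the point 0.\<close>
    have "(\<integral>\<^sup>+ t. ?f \<omega> t \<partial>lborel) = (\<integral>\<^sup>+ t. ennreal (exp (- (\<alpha> * t))) * indicator {S \<omega>..} t \<partial>lborel)"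
      by (intro nn_integral_cong_AE)
         (use AE_lborel_singleton[of 0] in eventually_elim, use S_nonneg[of \<omega>] in \<open>auto split: split_indicator\<close>)
    then show "(\<integral>\<^sup>+ t. ?f \<omega> t \<partial>lborel) = ennreal (exp (- (\<alpha> * S \<omega>)) / \<alpha>)"
      by (simp add: nn_integral_exp_Ici[OF \<alpha>])
  qed
  also have "\<dots> = ennreal (expectation (\<lambda>\<omega>. exp (- (\<alpha> * S \<omega>)) / \<alpha>))"
  proof (rule nn_integral_eq_integral)
    show "integrable M (\<lambda>\<omega>. exp (- (\<alpha> * S \<omega>)) / \<alpha>)"
      by (rule integrable_const_bound[where B="1 / \<alpha>"]) (use \<alpha> S_nonneg in \<open>auto simp: divide_right_mono\<close>)
  qed (use \<alpha> in auto)
  also have "expectation (\<lambda>\<omega>. exp (- (\<alpha> * S \<omega>)) / \<alpha>) = sqrt (\<alpha> * m) * pi * csch (sqrt (\<alpha> * m) * pi) / \<alpha>"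
    using expectation_exp_S[OF \<alpha>] by simp
  finally show ?thesis .
qed

lemma F_eq_theta_cdf:
  assumes "t > 0"
  shows "F t = theta_cdf m t"
proof (rule laplace_transform_unique[where F=F and G="theta_cdf m"])
  show "continuous_on {0<..} F"
    by (auto intro!: continuous_at_imp_continuous_on F_isCont)
  show "continuous_on {0<..} (theta_cdf m)"
    using DERIV_isCont[OF theta_cdf_deriv[OF m]] by (auto intro!: continuous_at_imp_continuous_on)
  show "(\<integral>\<^sup>+ t. ennreal (exp (- (real n * t)) * F t) * indicator {0<..} t \<partial>lborel)
      = (\<integral>\<^sup>+ t. ennreal (exp (- (real n * t)) * theta_cdf m t) * indicator {0<..} t \<partial>lborel)" if "n \<ge> 1" for n
    using that m by (simp add: F_laplace theta_cdf_laplace)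
  show "(\<integral>\<^sup>+ t. ennreal (exp (- t) * F t) * indicator {0<..} t \<partial>lborel) < \<infinity>"
    using F_laplace[of 1] by simp
qed (use assms m theta_cdf_nonneg in \<open>auto simp: F_def\<close>)

text \<open>The sign is not visible in the formula, a difference of nonnegative terms; a negative
  derivative would contradict the monotonicity of \<open>F\<close>.\<close>

lemma theta_density_nonneg:
  assumes x: "x > 0"
  shows "theta_density m x \<ge> 0"
proof (rule ccontr)
  assume "\<not> ?thesis"
  then have "theta_density m x < 0" by simp
  from DERIV_neg_dec_right[OF theta_cdf_deriv[OF m x] this] obtain d where
    d: "d > 0" "\<And>h. 0 < h \<Longrightarrow> h < d \<Longrightarrow> theta_cdf m (x + h) < theta_cdf m x" by blast
  have "theta_cdf m (x + d/2) < theta_cdf m x" using d(1) by (intro d(2)) auto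
  moreover have "F x \<le> F (x + d/2)" using d(1) by (intro F_mono) auto
  ultimately show False using x d(1) by (simp add: F_eq_theta_cdf)
qed

text \<open>A density is determined by its integrals over the sets \<open>{..a}\<close>; for
  positive \<open>a\<close> the fundamental theorem of calculus on (0, a) evaluates them.\<close>

lemma S_distributed: "distributed M lborel S (\<lambda>x. ennreal (theta_density m x) * indicator {0<..} x)"
proof -
  have eq: "(\<lambda>x. ennreal (theta_density m x) * indicator {0<..} x) = (\<lambda>x. ennreal (theta_density m x * indicator {0<..} x))"
    by (auto simp: fun_eq_iff split: split_indicator)
  show ?thesis
    unfolding eq
  proof (rule distributedI_borel_atMost[where g=F])
    fix a :: real
    show "emeasure M {\<omega> \<in> space M. S \<omega> \<le> a} = ennreal (F a)"
      by (simp add: F_def emeasure_eq_measure)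
    show "(\<integral>\<^sup>+ x. ennreal (theta_density m x * indicator {0<..} x * indicator {..a} x) \<partial>lborel) = ennreal (F a)"
    proof (cases "a \<le> 0")
      case True
      then have "(\<integral>\<^sup>+ x. ennreal (theta_density m x * indicator {0<..} x * indicator {..a} x) \<partial>lborel) = (\<integral>\<^sup>+ x. 0 \<partial>(lborel :: real measure))"
        by (intro nn_integral_cong) (auto split: split_indicator)
      with True show ?thesis by (simp add: F_nonpos)
    next
      case False
      have F0: "F 0 = 0" by (rule F_nonpos) simp
      \<comment> \<open>Taking \<open>F\<close> instead of the theta expression as antiderivative
        yields the limits at 0 and \<open>a\<close> from the continuity of \<open>F\<close>.\<close>
      have lim0: "(F \<longlongrightarrow> F 0) (at_right 0)" and lima: "(F \<longlongrightarrow> F a) (at_left a)"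
        using F_isCont by (auto simp: isCont_def intro: tendsto_mono at_le)
      have FT: "(F has_real_derivative theta_density m x) (at x)" if "x > 0" for x
        by (rule has_field_derivative_transform_within_open[OF theta_cdf_deriv[OF m that], where S="{0<..}"])
           (use that F_eq_theta_cdf in auto)
      have *: "set_integrable lborel (einterval 0 (ereal a)) (theta_density m)"
         "(LBINT x=0..ereal a. theta_density m x) = F a - F 0"
        using False m lim0 lima FT isCont_theta_density theta_density_nonneg
        by (intro interval_integral_FTC_nonneg[where F = F];
            force simp: ereal_tendsto_simps zero_ereal_def)+
      have "(\<integral>\<^sup>+ x. ennreal (theta_density m x * indicator {0<..} x * indicator {..a} x) \<partial>lborel)
          = (\<integral>\<^sup>+ x. ennreal (indicator {0<..<a} x *\<^sub>R theta_density m x) \<partial>lborel)"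
        by (intro nn_integral_cong_AE)
           (use AE_lborel_singleton[of a] in \<open>eventually_elim, auto split: split_indicator\<close>)
      also have "\<dots> = ennreal (LINT x|lborel. indicator {0<..<a} x *\<^sub>R theta_density m x)"
        using *(1) theta_density_nonneg
        by (intro nn_integral_eq_integral) (auto simp: set_integrable_def zero_ereal_def split: split_indicator)
      also have "(LINT x|lborel. indicator {0<..<a} x *\<^sub>R theta_density m x) = (LBINT x=0..ereal a. theta_density m x)"
        using False by (simp add: interval_lebesgue_integral_def set_lebesgue_integral_def zero_ereal_def)
      finally show ?thesis
        by (simp add: *(2) F0)
    qed
  qed (use theta_density_nonneg in \<open>auto split: split_indicator\<close>)
qed

end

subsection \<open>Integration against the random measure\<close>

lemma range_Suc_atLeast: "range Suc = {1..}"
  using greaterThan_0 by auto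

lemma infsum_ennreal_atLeast_1:
  fixes v :: "nat \<Rightarrow> ennreal"
  shows "(\<Sum>\<^sub>\<infinity>x\<in>{1..}. v x) = (\<Sum>k. v (Suc k))"
proof -
  have "(v has_sum (\<Sum>\<^sub>\<infinity>x\<in>{1..}. v x)) (Suc ` UNIV)"
    unfolding range_Suc_atLeast by (intro has_sum_infsum nonneg_summable_on_complete) simp
  then have "((\<lambda>k. v (Suc k)) has_sum (\<Sum>\<^sub>\<infinity>x\<in>{1..}. v x)) UNIV"
    by (subst (asm) has_sum_reindex) (auto simp: comp_def)
  then show ?thesis
    by (metis has_sum_imp_sums sums_unique)
qed

text \<open>The measure is the image of a weighted counting measure under the map from
  \<open>k\<close> to \<open>k + 1\<close>, so integration against it becomes summation.\<close>

lemma nn_integral_atoms: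
  fixes w :: "nat \<Rightarrow> ennreal" and N :: "real measure"
  assumes sets: "sets N = sets borel_pos"
    and N: "\<And>A. A \<in> sets borel_pos \<Longrightarrow> emeasure N A = (\<Sum>\<^sub>\<infinity>x\<in>{1..}. w x * indicator A (real x))"
    and g [measurable]: "g \<in> borel_measurable borel_pos"
  shows "(\<integral>\<^sup>+ x. g x \<partial>N) = (\<Sum>k. w (Suc k) * g (real (Suc k)))"
proof -
  let ?D = "density (count_space UNIV) (\<lambda>k. w (Suc k))"
  let ?r = "\<lambda>k. real (Suc k)"
  have r [measurable]: "?r \<in> ?D \<rightarrow>\<^sub>M borel_pos"
    by (auto simp: measurable_def space_restrict_space)
  have "N = distr ?D borel_pos ?r"
  proof (rule measure_eqI)
    show "sets N = sets (distr ?D borel_pos ?r)"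
      using sets by simp
    fix A assume "A \<in> sets N"
    then have A: "A \<in> sets borel_pos" by (simp add: sets)
    have "emeasure (distr ?D borel_pos ?r) A = emeasure ?D (?r -` A)"
      using A by (subst emeasure_distr) auto
    also have "\<dots> = (\<integral>\<^sup>+ k. w (Suc k) * indicator A (?r k) \<partial>count_space UNIV)"
      by (subst emeasure_density) (auto intro!: nn_integral_cong split: split_indicator)
    also have "\<dots> = (\<Sum>k. w (Suc k) * indicator A (?r k))"
      by (rule nn_integral_count_space_nat)
    finally show "emeasure N A = emeasure (distr ?D borel_pos ?r) A"
      by (simp only: N[OF A] infsum_ennreal_atLeast_1)
  qed
  then have "(\<integral>\<^sup>+ x. g x \<partial>N) = (\<integral>\<^sup>+ k. g (?r k) \<partial>?D)"
    by (simp add: nn_integral_distr)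
  also have "\<dots> = (\<integral>\<^sup>+ k. w (Suc k) * g (?r k) \<partial>count_space UNIV)"
    by (subst nn_integral_density) auto
  also have "\<dots> = (\<Sum>k. w (Suc k) * g (?r k))"
    by (rule nn_integral_count_space_nat)
  finally show ?thesis .
qed

text \<open>This treats one fixed sample point. The nonnegative integral of \<open>f\<close> is
  \<open>weighted_total\<close>, so the equation with \<open>S\<close> persists in the infinite
  case, where both sides are 0.\<close>

lemma
  fixes f :: "real \<Rightarrow> real" and N :: "real measure"
  assumes W: "exponential_weights M m W"
    and sets: "sets N = sets borel_pos"
    and N: "\<And>A. A \<in> sets borel_pos \<Longrightarrow>
           emeasure N A = (\<Sum>\<^sub>\<infinity>x\<in>{1..}. ennreal (W x \<omega>) * indicator A (real x))"
    and f: "\<And>x. x > 0 \<Longrightarrow> f x = 1 / x\<^sup>2"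
  shows integral_inverse_square_atoms: "(LINT x|N. f x) = exponential_weights.S W \<omega>"
    and integrable_inverse_square_atoms:
      "exponential_weights.weighted_total W \<omega> \<noteq> \<infinity> \<Longrightarrow> integrable N f"
proof -
  interpret exponential_weights M m W by fact
  have space: "space N = {0<..}"
    using sets_eq_imp_space_eq[OF sets] by (simp add: space_restrict_space)
  have f_borel: "f \<in> borel_measurable borel_pos"
  proof -
    have "(\<lambda>x. 1 / x\<^sup>2) \<in> borel_measurable borel_pos"
      by (rule measurable_restrict_space1) measurable
    then show ?thesis
      by (subst measurable_cong[where g="\<lambda>x. 1 / x\<^sup>2"]) (auto simp: space_restrict_space f)
  qed
  then have f_N: "f \<in> borel_measurable N"
    by (subst measurable_cong_sets[OF sets refl])
  have "(\<integral>\<^sup>+ x. ennreal (f x) \<partial>N) = (\<Sum>k. ennreal (W (Suc k) \<omega>) * ennreal (f (real (Suc k))))"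
    using measurable_compose[OF f_borel measurable_ennreal] by (intro nn_integral_atoms sets N)
  also have "\<dots> = weighted_total \<omega>"
    by (simp add: weighted_total_def f del: of_nat_Suc)
  finally have eq: "(\<integral>\<^sup>+ x. ennreal (f x) \<partial>N) = weighted_total \<omega>" .
  have nonneg: "AE x in N. 0 \<le> f x"
    by (rule AE_I2) (simp add: space f)
  show "(LINT x|N. f x) = S \<omega>"
    by (subst integral_eq_nn_integral[OF f_N nonneg]) (simp add: eq S_def)
  show "integrable N f" if "weighted_total \<omega> \<noteq> \<infinity>"
    using that by (intro integrableI_nonneg f_N nonneg) (simp add: eq less_top)
qed

theorem theorem1:
  fixes M :: "'a measure" and m :: real and W :: "nat \<Rightarrow> 'a \<Rightarrow> real"
    and N :: "'a \<Rightarrow> real measure" and f :: "real \<Rightarrow> real" and Nf :: "'a \<Rightarrow> real"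
  assumes M: "prob_space M"
    and m: "m > 0"
    and W_indep: "prob_space.indep_vars M (\<lambda>_. borel) W {1..}"
    and W_exp: "\<And>x. x \<ge> 1 \<Longrightarrow> distributed M lborel (W x) (exponential_density (1 / m))"
    and N_sets: "\<And>\<omega>. \<omega> \<in> space M \<Longrightarrow> sets (N \<omega>) = sets borel_pos"
    and N_emeasure: "\<And>\<omega> A. \<omega> \<in> space M \<Longrightarrow> A \<in> sets borel_pos \<Longrightarrow>
           emeasure (N \<omega>) A = (\<Sum>\<^sub>\<infinity>x\<in>{1..}. ennreal (W x \<omega>) * indicator A (real x))"
    and f: "\<And>x. x > 0 \<Longrightarrow> f x = 1 / x\<^sup>2"
    and Nf: "\<And>\<omega>. \<omega> \<in> space M \<Longrightarrow> Nf \<omega> = (LINT x|N \<omega>. f x)"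
  shows "Nf \<in> borel_measurable M
    \<and> (AE \<omega> in M. integrable (N \<omega>) f \<and> ((\<lambda>x. W x \<omega> / (real x)\<^sup>2) has_sum Nf \<omega>) {1..})
    \<and> (\<forall>\<alpha>\<ge>0. (LINT \<omega>|M. exp (- \<alpha> * Nf \<omega>)) =
          (if \<alpha> = 0 then 1 else sqrt (\<alpha> * m) * pi * csch (sqrt (\<alpha> * m) * pi)))
    \<and> (\<forall>x>0. \<P>(\<omega> in M. Nf \<omega> \<le> x) =
          sqrt (m * pi / x) * jacobi_theta2 0 (exp (- (m * pi\<^sup>2 / x))))
    \<and> (\<exists>g :: real \<Rightarrow> real.
          (\<forall>x>0. g x \<ge> 0 \<and>
             g x = (let q = exp (- (m * pi\<^sup>2 / x)) in
               sqrt (m * pi) / (2 * x powr (5/2)) *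
               (2 * m * pi\<^sup>2 *
                  (jacobi_theta2 0 q / 4 +
                   2 * q * (\<Sum>\<^sub>\<infinity>k\<in>{1::nat..}. real (k * (k + 1)) * q powr (real (k * (k + 1)) - 3/4)))
                - x * jacobi_theta2 0 q)))
          \<and> distributed M lborel Nf (\<lambda>x. ennreal (g x) * indicator {0<..} x))"
proof (intro conjI)
  have ew: "exponential_weights M m W"
    unfolding exponential_weights_def exponential_weights_axioms_def
    using M m W_indep W_exp by simp
  then interpret exponential_weights M m W .
  \<comment> \<open>Equality at every point of the space, not only almost everywhere, transfers
    measurability to \<open>Nf\<close> although \<open>M\<close> is not assumed complete.\<close>
  have Nf_S: "Nf \<omega> = S \<omega>" if "\<omega> \<in> space M" for \<omega>
    using integral_inverse_square_atoms[OF ew N_sets[OF that] N_emeasure[OF that] f] Nf[OF that] by simp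
  show "Nf \<in> borel_measurable M"
    using S_measurable by (subst measurable_cong[OF Nf_S])
  show "AE \<omega> in M. integrable (N \<omega>) f \<and> ((\<lambda>x. W x \<omega> / (real x)\<^sup>2) has_sum Nf \<omega>) {1..}"
    using weighted_total_finite S_sums W_nonneg AE_space
  proof eventually_elim
    case (elim \<omega>)
    have "((\<lambda>k. W (Suc k) \<omega> / (real (Suc k))\<^sup>2) has_sum S \<omega>) UNIV"
      using elim by (intro norm_summable_imp_has_sum) (auto simp: sums_iff)
    then have "((\<lambda>x. W x \<omega> / (real x)\<^sup>2) has_sum S \<omega>) (Suc ` UNIV)"
      by (subst has_sum_reindex) (auto simp: comp_def)
    then show ?case
      using integrable_inverse_square_atoms[OF ew N_sets[OF elim(4)] N_emeasure[OF elim(4)] f elim(1)] elim(4)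
      by (simp add: Nf_S range_Suc_atLeast)
  qed
  show "\<forall>\<alpha>\<ge>0. (LINT \<omega>|M. exp (- \<alpha> * Nf \<omega>)) =
          (if \<alpha> = 0 then 1 else sqrt (\<alpha> * m) * pi * csch (sqrt (\<alpha> * m) * pi))"
  proof (intro allI impI)
    fix \<alpha> :: real assume "\<alpha> \<ge> 0"
    have "(LINT \<omega>|M. exp (- \<alpha> * Nf \<omega>)) = expectation (\<lambda>\<omega>. exp (- (\<alpha> * S \<omega>)))"
      by (intro Bochner_Integration.integral_cong) (auto simp: Nf_S)
    then show "(LINT \<omega>|M. exp (- \<alpha> * Nf \<omega>)) =
          (if \<alpha> = 0 then 1 else sqrt (\<alpha> * m) * pi * csch (sqrt (\<alpha> * m) * pi))"
      using \<open>\<alpha> \<ge> 0\<close> by (simp add: expectation_exp_S prob_space)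
  qed
  show "\<forall>x>0. \<P>(\<omega> in M. Nf \<omega> \<le> x) =
          sqrt (m * pi / x) * jacobi_theta2 0 (exp (- (m * pi\<^sup>2 / x)))"
  proof (intro allI impI)
    fix x :: real assume x: "x > 0"
    have "\<P>(\<omega> in M. Nf \<omega> \<le> x) = F x"
      unfolding F_def by (intro arg_cong[where f=prob] Collect_cong) (auto simp: Nf_S)
    then show "\<P>(\<omega> in M. Nf \<omega> \<le> x) = sqrt (m * pi / x) * jacobi_theta2 0 (exp (- (m * pi\<^sup>2 / x)))"
      using x m jacobi_theta2_eq_theta_half[of "m * pi\<^sup>2 / x"] by (simp add: F_eq_theta_cdf theta_cdf_def)
  qed
  show "\<exists>g :: real \<Rightarrow> real.
          (\<forall>x>0. g x \<ge> 0 \<and>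
             g x = (let q = exp (- (m * pi\<^sup>2 / x)) in
               sqrt (m * pi) / (2 * x powr (5/2)) *
               (2 * m * pi\<^sup>2 *
                  (jacobi_theta2 0 q / 4 +
                   2 * q * (\<Sum>\<^sub>\<infinity>k\<in>{1::nat..}. real (k * (k + 1)) * q powr (real (k * (k + 1)) - 3/4)))
                - x * jacobi_theta2 0 q)))
          \<and> distributed M lborel Nf (\<lambda>x. ennreal (g x) * indicator {0<..} x)"
  proof (intro exI[of _ "theta_density m"] conjI allI impI)
    fix x :: real assume x: "x > 0"
    show "theta_density m x \<ge> 0" using x by (rule theta_density_nonneg)
    have y: "m * pi\<^sup>2 / x > 0" using x m by simp
    show "theta_density m x = (let q = exp (- (m * pi\<^sup>2 / x)) in
               sqrt (m * pi) / (2 * x powr (5/2)) *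
               (2 * m * pi\<^sup>2 *
                  (jacobi_theta2 0 q / 4 +
                   2 * q * (\<Sum>\<^sub>\<infinity>k\<in>{1::nat..}. real (k * (k + 1)) * q powr (real (k * (k + 1)) - 3/4)))
                - x * jacobi_theta2 0 q))"
      \<comment> \<open>The bracket is collapsed first, because it contains a theta value that the
        next rewriting would change.\<close>
      unfolding Let_def theta_half_1_eq[OF y]
      unfolding jacobi_theta2_eq_theta_half[OF y] theta_density_def ..
  next
    have "distr M lborel Nf = distr M lborel S"
      by (rule distr_cong) (auto simp: Nf_S)
    moreover have "Nf \<in> borel_measurable M \<longleftrightarrow> S \<in> borel_measurable M"
      by (rule measurable_cong) (rule Nf_S)
    ultimately show "distributed M lborel Nf (\<lambda>x. ennreal (theta_density m x) * indicator {0<..} x)"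
      using S_distributed by (simp add: distributed_def)
  qed
qed

end
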